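(* Let $A$ be a noninvertible $S_n$-matrix. Then: (a) $a(A)$ equals the algebraic multiplicity of the eigenvalue $0$ of $A$; (b) $p(A)=a(A)$ or $p(A)=\infty$; (c) $p(A)=\infty$ if and only if $A$ is unitarily similar to $J_n$; (d) $\operatorname{rank}A^j=n-j$ for $1\le j\le a(A)$.
   Context: An $n$-by-$n$ complex matrix $A$ is an $S_n$-matrix (of class $S_n$) if $\|A\|\le 1$ (operator norm), all eigenvalues of $A$ lie in the open unit disc $\{z\in\mathbb{C}:|z|<1\}$, and $\operatorname{rank}(I_n-A^*A)=1$. The ascent $a(A)$ is the minimal integer $k\ge 0$ with $\ker A^k=\ker A^{k+1}$ (where $A^0=I_n$). A matrix $M$ is a partial isometry if $\|Mx\|=\|x\|$ for every $x\in(\ker M)^\perp$. The power partial isometry index is $p(A)=\sup\{k\ge 0: I,A,A^2,\ldots,A^k\text{ are all partial isometries}\}\in\{0,1,2,\ldots\}\cup\{\infty\}$. $J_n$ is the $n$-by-$n$ nilpotent Jordan block, with $1$'s on the first superdiagonal and $0$'s elsewhere. Algebraic multiplicity means multiplicity as a zero of the characteristic polynomial. *)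

theory Defs
  imports
    Complex_Main
    "HOL-Library.Extended_Nat"
    "Jordan_Normal_Form.Schur_Decomposition"
    "Jordan_Normal_Form.Jordan_Normal_Form"
    "Jordan_Normal_Form.Matrix_Kernel"
    "Jordan_Normal_Form.DL_Rank"
begin

definition vec_norm :: "complex vec \<Rightarrow> real" where
  "vec_norm v = sqrt (\<Sum>i<dim_vec v. (cmod (v $ i))\<^sup>2)"

definition op_norm :: "complex mat \<Rightarrow> real" where
  "op_norm A = (SUP x \<in> {x \<in> carrier_vec (dim_col A). vec_norm x \<le> 1}. vec_norm (A *\<^sub>v x))"

definition S_matrix :: "nat \<Rightarrow> complex mat \<Rightarrow> bool" where
  "S_matrix n A \<longleftrightarrow>
     A \<in> carrier_mat n n \<and>
     op_norm A \<le> 1 \<and>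
     (\<forall>z. eigenvalue A z \<longrightarrow> cmod z < 1) \<and>
     vec_space.rank n (1\<^sub>m n - mat_adjoint A * A) = 1"

text \<open>For a square matrix the chain of kernels stabilises, so the minimum below is attained.\<close>

definition ascent :: "complex mat \<Rightarrow> nat" where
  "ascent A = (LEAST k. mat_kernel (A ^\<^sub>m k) = mat_kernel (A ^\<^sub>m (k + 1)))"

text \<open>The library's \<open>orthogonal_complement\<close> is taken with respect to the bilinear product, so it
  is not the Hilbert space complement over the complex numbers.  The sesquilinear product
  \<open>\<bullet>c\<close> is used instead.\<close>

definition kernel_perp :: "complex mat \<Rightarrow> complex vec set" where
  "kernel_perp M = {x \<in> carrier_vec (dim_col M). \<forall>y \<in> mat_kernel M. x \<bullet>c y = 0}"

definition partial_isometry :: "complex mat \<Rightarrow> bool" where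
  "partial_isometry M \<longleftrightarrow> (\<forall>x \<in> kernel_perp M. vec_norm (M *\<^sub>v x) = vec_norm x)"

definition ppi_index :: "complex mat \<Rightarrow> enat" where
  "ppi_index A = (SUP k \<in> {k. \<forall>j \<le> k. partial_isometry (A ^\<^sub>m j)}. enat k)"

text \<open>\<open>similar_mat_wit A B U V\<close> includes \<open>U * V = 1\<close> and \<open>V * U = 1\<close>, so with \<open>V\<close> the
  adjoint of \<open>U\<close> it says that \<open>U\<close> is unitary and \<open>A = U * B * V\<close>.\<close>

definition unitarily_similar :: "complex mat \<Rightarrow> complex mat \<Rightarrow> bool" where
  "unitarily_similar A B \<longleftrightarrow> (\<exists>U. similar_mat_wit A B U (mat_adjoint U))"

end

theory Submission
  imports
    Defs
    "Jordan_Normal_Form.Spectral_Radius"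
    "Jordan_Normal_Form.Jordan_Normal_Form_Uniqueness"
begin

text \<open>Since \<open>I - A\<^sup>*A\<close> has rank one and fixes the nonzero kernel of \<open>A\<close>, there is a unit vector
  \<open>v\<close> with \<open>ker A = span v\<close> and \<open>I - A\<^sup>*A = \<langle>\<cdot>, v\<rangle> v\<close>.  Hence \<open>A\<close> has a single Jordan block for the
  eigenvalue 0, so that \<open>dim ker A\<^sup>k = min k m\<close> with \<open>m\<close> the multiplicity; this settles the ascent and
  the ranks.  The vectors \<open>e\<^sub>i = (A\<^sup>*)\<^sup>i v\<close> for \<open>i < m\<close> form an orthonormal Jordan chain whose
  initial segments span the kernels of the powers \<open>A\<^sup>j\<close>, \<open>j \<le> m\<close>, and
  \<open>\<parallel>x\<parallel>\<^sup>2 - \<parallel>A\<^sup>k x\<parallel>\<^sup>2 = \<Sum>\<^bsub>i<k\<^esub> |\<langle>x, e\<^sub>i\<rangle>|\<^sup>2\<close> shows that these powers are partial isometries.  If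
  \<open>A\<^bsup>m+1\<^esup>\<close> is one as well, then the orthogonal complement of \<open>ker A\<^sup>m\<close> is invariant under \<open>A\<close> and
  \<open>A\<close> is isometric on it; as the spectral radius is below 1, this complement vanishes, and the
  \<open>e\<^sub>i\<close> form an orthonormal basis in which \<open>A\<close> is the nilpotent Jordan block.\<close>

section \<open>Rank, kernel dimension and the adjoint\<close>

lemma mat_rank_nullity:
  fixes A :: "'a :: field mat"
  assumes A: "A \<in> carrier_mat n n"
  shows "vec_space.rank n A + kernel_dim A = n"
proof -
  interpret V: vec_space "TYPE('a)" n .
  interpret K: kernel n n A by unfold_locales (rule A)
  interpret L: linear_map class_ring V.V V.V "\<lambda>x. A *\<^sub>v x"
    by unfold_locales (use A in \<open>auto simp: mult_add_distrib_mat_vec[OF A] module_hom_def\<close>)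
  have im: "L.im = V.span (set (cols A))"
    using V.col_space_eq[OF A] A unfolding V.col_space_def L.im_def by auto
  have ker: "L.ker = mat_kernel A"
    unfolding L.ker_def mat_kernel[OF A] by auto
  show ?thesis
    using L.rank_nullity[OF V.fin_dim] unfolding im ker V.rank_def V.dim_is_n K.kernel_dim by simp
qed

lemma kernel_dim_cong:
  assumes "dim_col A = dim_col B" "mat_kernel A = mat_kernel B"
  shows "kernel_dim A = kernel_dim B"
  using assms unfolding kernel_dim_def by simp

text \<open>A basis of the smaller kernel stays independent in the larger one and already has the
  right number of elements to be a basis there.\<close>

lemma mat_kernel_eqI:
  fixes A B :: "'a :: field mat"
  assumes A: "A \<in> carrier_mat n n" and B: "B \<in> carrier_mat n n"
    and sub: "mat_kernel A \<subseteq> mat_kernel B" and dim: "kernel_dim A = kernel_dim B"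
  shows "mat_kernel A = mat_kernel B"
proof -
  interpret KA: kernel n n A by unfold_locales (rule A)
  interpret KB: kernel n n B by unfold_locales (rule B)
  obtain S where fin: "finite S" and S: "KA.basis S" using kernel_basis_exists[OF A] by auto
  have SA: "S \<subseteq> mat_kernel A" using S unfolding KA.Ker.basis_def by auto
  hence SB: "S \<subseteq> mat_kernel B" using sub by auto
  have li: "KB.lin_indpt S"
    using S KA.lindep_same[OF SA] KB.lindep_same[OF SB] unfolding KA.Ker.basis_def by auto
  obtain T where "finite T" "KB.basis T" using kernel_basis_exists[OF B] by auto
  hence fd: "KB.Ker.fin_dim" unfolding KB.Ker.fin_dim_def KB.Ker.basis_def by auto
  have "KB.basis S"
    by (rule KB.Ker.dim_li_is_basis[OF fd fin _ li]) (use SB KA.Ker.dim_basis[OF fin S] dim in auto)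
  thus ?thesis using S KA.span_same[OF SA] KB.span_same[OF SB]
    unfolding KA.Ker.basis_def KB.Ker.basis_def by simp
qed

text \<open>The column space is one-dimensional, so the single nonzero vector
  \<open>B *\<^sub>v x\<close> is a basis of it and every other image is a multiple of it.\<close>

lemma rank_one_range:
  fixes B :: "'a :: field mat"
  assumes B: "B \<in> carrier_mat n n" and rank: "vec_space.rank n B = 1"
    and x: "x \<in> carrier_vec n" and Bx: "B *\<^sub>v x \<noteq> 0\<^sub>v n" and y: "y \<in> carrier_vec n"
  obtains c where "B *\<^sub>v y = c \<cdot>\<^sub>v (B *\<^sub>v x)"
proof -
  interpret V: vec_space "TYPE('a)" n .
  let ?W = "V.col_space B"
  have cols: "set (cols B) \<subseteq> carrier_vec n" using B cols_dim by blast
  interpret W: vectorspace class_ring "V.vs ?W"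
    unfolding V.col_space_def using V.span_is_subspace[OF cols] V.subspace_is_vs by auto
  have sub: "submodule class_ring ?W V.V"
    unfolding V.col_space_def by (rule V.span_is_submodule) (use cols in auto)
  have fd: "W.fin_dim" unfolding V.col_space_def by (rule V.fin_dim_span_cols[OF B])
  have d: "W.dim = 1" using rank unfolding V.rank_def V.col_space_def .
  have in_W: "B *\<^sub>v z \<in> ?W" if "z \<in> carrier_vec n" for z
    using that B unfolding V.col_space_eq[OF B] by auto
  let ?u = "B *\<^sub>v x"
  have u: "?u \<in> carrier_vec n" using B x by auto
  have "V.lin_indpt {?u}"
  proof (rule V.finite_lin_indpt2)
    fix a assume "V.lincomb a {?u} = 0\<^sub>v n"
    hence "a ?u \<cdot>\<^sub>v ?u = 0\<^sub>v n" using u by (simp add: V.lincomb_def)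
    moreover obtain i where "i < n" "?u $ i \<noteq> 0"
      using Bx u by (metis carrier_vecD eq_vecI index_zero_vec)
    ultimately have "a ?u = 0" using u by (metis carrier_vecD index_smult_vec(1) index_zero_vec(1) mult_eq_0_iff)
    thus "\<forall>w\<in>{?u}. a w = 0" by simp
  qed (use u in auto)
  hence "W.lin_indpt {?u}" using V.span_li_not_depend(2)[OF _ sub, of "{?u}"] in_W[OF x] by auto
  hence "W.basis {?u}"
    by (intro W.dim_li_is_basis[OF fd]) (use in_W[OF x] d in auto)
  hence "V.span {?u} = ?W"
    using V.span_li_not_depend(1)[OF _ sub, of "{?u}"] in_W[OF x] unfolding W.basis_def by auto
  hence "B *\<^sub>v y \<in> V.span {?u}" using in_W[OF y] by simp
  then obtain a where "B *\<^sub>v y = V.lincomb a {?u}"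
    using V.finite_span[of "{?u}"] u by auto
  hence "B *\<^sub>v y = a ?u \<cdot>\<^sub>v ?u" using u by (simp add: V.lincomb_def)
  thus ?thesis using that by auto
qed

lemma adjoint_cscalar_prod:
  fixes A :: "complex mat"
  assumes A: "A \<in> carrier_mat n n" and x: "x \<in> carrier_vec n" and y: "y \<in> carrier_vec n"
  shows "(A *\<^sub>v x) \<bullet>c y = x \<bullet>c (mat_adjoint A *\<^sub>v y)"
proof -
  have "(A *\<^sub>v x) \<bullet>c y = (\<Sum>i<n. \<Sum>j<n. A $$ (i,j) * x $ j * cnj (y $ i))"
    using A x y by (auto simp: scalar_prod_def sum_distrib_right atLeast0LessThan intro!: sum.cong)
  also have "\<dots> = (\<Sum>j<n. \<Sum>i<n. A $$ (i,j) * x $ j * cnj (y $ i))"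
    by (rule sum.swap)
  also have "\<dots> = x \<bullet>c (mat_adjoint A *\<^sub>v y)"
    using A x y by (auto simp: scalar_prod_def sum_distrib_left atLeast0LessThan mat_adjoint_def
        mat_of_rows_def ac_simps intro!: sum.cong)
  finally show ?thesis .
qed

lemma mat_adjoint_carrier [simp]:
  "A \<in> carrier_mat n m \<Longrightarrow> mat_adjoint A \<in> carrier_mat m n"
  unfolding mat_adjoint_def by (auto simp: cols_def)

lemma cscalar_prod_self: "x \<bullet>c x = complex_of_real ((vec_norm x)\<^sup>2)"
proof -
  have "x \<bullet>c x = (\<Sum>i<dim_vec x. complex_of_real ((cmod (x $ i))\<^sup>2))"
    by (auto simp: scalar_prod_def atLeast0LessThan simp flip: complex_norm_square intro!: sum.cong)
  also have "\<dots> = complex_of_real ((vec_norm x)\<^sup>2)"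
    unfolding vec_norm_def by (simp add: sum_nonneg)
  finally show ?thesis .
qed

lemma vec_norm_ge_0: "0 \<le> vec_norm x"
  unfolding vec_norm_def by (simp add: sum_nonneg)

section \<open>Kernels of powers and the ascent\<close>

text \<open>In a Jordan form, a block of size m for the eigenvalue 0 contributes min k m to the
  kernel of the k-th power. At k = 1 this counts such blocks, so there is exactly one, and its size
  is the multiplicity of 0.\<close>

lemma kernel_dim_pow_eq_min:
  fixes A :: "complex mat"
  assumes A: "A \<in> carrier_mat n n" and ker: "kernel_dim A = 1"
  shows "kernel_dim (A ^\<^sub>m k) = min k (order 0 (char_poly A))"
proof -
  obtain es where es: "char_poly A = (\<Prod>a\<leftarrow>es. [:- a, 1:])"
    using char_poly_factorized[OF A] by auto
  obtain bs where jnf: "jordan_nf A bs" using jordan_nf_exists[OF A es] by auto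
  define ms where "ms = map fst [(m, e)\<leftarrow>bs . e = 0]"
  have char0: "char_matrix A 0 = A" using A unfolding char_matrix_def by auto
  have dim: "kernel_dim (A ^\<^sub>m k) = (\<Sum>m\<leftarrow>ms. min k m)" for k
    using dim_gen_eigenspace[OF jnf, of 0 k] unfolding dim_gen_eigenspace_def char0 ms_def .
  have ord: "order 0 (char_poly A) = sum_list ms"
    unfolding jordan_nf_order[OF jnf] ms_def by (simp add: case_prod_beta')
  have pos: "\<forall>m\<in>set ms. m > 0"
    using jnf unfolding jordan_nf_def ms_def by force
  have "(\<Sum>m\<leftarrow>ms. min 1 m) = length ms" using pos by (induct ms) auto
  moreover have "A ^\<^sub>m 1 = A" using A by simp
  ultimately have "length ms = 1" using dim[of 1] ker by simp
  then obtain m where "ms = [m]" by (cases ms) auto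
  thus ?thesis unfolding dim ord by simp
qed

lemma pow_mat_mult_vec:
  assumes A: "A \<in> carrier_mat n n" and x: "x \<in> carrier_vec n"
  shows "A ^\<^sub>m (Suc k) *\<^sub>v x = A ^\<^sub>m k *\<^sub>v (A *\<^sub>v x)"
  using assms assoc_mult_mat_vec[of "A ^\<^sub>m k" n n A n x] by simp

lemma pow_mat_mult_vec_left:
  assumes A: "A \<in> carrier_mat n n" and x: "x \<in> carrier_vec n"
  shows "A ^\<^sub>m (Suc k) *\<^sub>v x = A *\<^sub>v (A ^\<^sub>m k *\<^sub>v x)"
  using x
proof (induct k arbitrary: x)
  case 0 thus ?case using A by simp
next
  case (Suc k)
  have Ax: "A *\<^sub>v x \<in> carrier_vec n" using A Suc(2) by auto
  show ?case unfolding pow_mat_mult_vec[OF A Suc(2)] Suc(1)[OF Ax] ..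
qed

lemma pow_mat_add_mult_vec:
  assumes A: "A \<in> carrier_mat n n" and x: "x \<in> carrier_vec n"
  shows "A ^\<^sub>m (i + j) *\<^sub>v x = A ^\<^sub>m i *\<^sub>v (A ^\<^sub>m j *\<^sub>v x)"
proof (induct i)
  case 0
  have "A ^\<^sub>m j *\<^sub>v x \<in> carrier_vec n" using A x by (metis mult_mat_vec_carrier pow_carrier_mat)
  thus ?case using A by simp
next
  case (Suc i)
  have "A ^\<^sub>m j *\<^sub>v x \<in> carrier_vec n" using A x by (metis mult_mat_vec_carrier pow_carrier_mat)
  from pow_mat_mult_vec_left[OF A this] pow_mat_mult_vec_left[OF A x] Suc show ?case by simp
qed

lemma mult_mat_zero_vec:
  "A \<in> carrier_mat nr nc \<Longrightarrow> A *\<^sub>v 0\<^sub>v nc = (0\<^sub>v nr :: 'a :: semiring_0 vec)"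
  by (intro eq_vecI) auto

lemma mem_mat_kernel_pow:
  assumes "A \<in> carrier_mat n n"
  shows "x \<in> mat_kernel (A ^\<^sub>m k) \<longleftrightarrow> x \<in> carrier_vec n \<and> A ^\<^sub>m k *\<^sub>v x = 0\<^sub>v n"
  using mat_kernel[of "A ^\<^sub>m k" n n] assms by auto

lemma mat_kernel_pow_subset:
  assumes A: "A \<in> carrier_mat n n" and "i \<le> j"
  shows "mat_kernel (A ^\<^sub>m i) \<subseteq> mat_kernel (A ^\<^sub>m j)"
proof
  fix x assume "x \<in> mat_kernel (A ^\<^sub>m i)"
  hence x: "x \<in> carrier_vec n" and 0: "A ^\<^sub>m i *\<^sub>v x = 0\<^sub>v n"
    unfolding mem_mat_kernel_pow[OF A] by auto
  have "A ^\<^sub>m j *\<^sub>v x = A ^\<^sub>m (j - i) *\<^sub>v (A ^\<^sub>m i *\<^sub>v x)"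
    using pow_mat_add_mult_vec[OF A x, of "j - i" i] assms(2) by simp
  also have "\<dots> = 0\<^sub>v n" unfolding 0 using pow_carrier_mat[OF A, of "j - i"] by (rule mult_mat_zero_vec)
  finally show "x \<in> mat_kernel (A ^\<^sub>m j)" unfolding mem_mat_kernel_pow[OF A] using x by simp
qed

text \<open>The dimensions min k m are constant from k = m on and strictly increasing before; nested
  kernels of equal dimension coincide.\<close>

lemma ascent_eq_order:
  fixes A :: "complex mat"
  assumes A: "A \<in> carrier_mat n n" and ker: "kernel_dim A = 1"
  shows "ascent A = order 0 (char_poly A)"
proof -
  let ?m = "order 0 (char_poly A)"
  note dim = kernel_dim_pow_eq_min[OF A ker]
  show ?thesis unfolding ascent_def
  proof (rule Least_equality)
    show "mat_kernel (A ^\<^sub>m ?m) = mat_kernel (A ^\<^sub>m (?m + 1))"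
      by (rule mat_kernel_eqI[of _ n])
        (use A mat_kernel_pow_subset[OF A, of ?m "?m + 1"] dim[of ?m] dim[of "?m + 1"] in auto)
  next
    fix k assume eq: "mat_kernel (A ^\<^sub>m k) = mat_kernel (A ^\<^sub>m (k + 1))"
    have "kernel_dim (A ^\<^sub>m k) = kernel_dim (A ^\<^sub>m (k + 1))"
      by (rule kernel_dim_cong[OF _ eq]) (use A in auto)
    thus "?m \<le> k" unfolding dim by simp
  qed
qed

lemma kernel_dim_singleton:
  fixes A :: "'a :: field mat"
  assumes A: "A \<in> carrier_mat n n" and v: "v \<in> mat_kernel A" "v \<noteq> 0\<^sub>v n"
    and span: "\<And>x. x \<in> mat_kernel A \<Longrightarrow> \<exists>c. x = c \<cdot>\<^sub>v v"
  shows "kernel_dim A = 1"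
proof -
  interpret K: kernel n n A by unfold_locales (rule A)
  have vc: "v \<in> carrier_vec n" using mat_kernelD[OF A v(1)] by simp
  have "K.span {v} = mat_kernel A"
  proof (rule subset_antisym)
    show "K.span {v} \<subseteq> mat_kernel A" using K.Ker.span_is_subset2[of "{v}"] v by auto
    show "mat_kernel A \<subseteq> K.span {v}"
    proof
      fix x assume "x \<in> mat_kernel A"
      then obtain c where c: "x = c \<cdot>\<^sub>v v" using span by blast
      have "x = K.NC.lincomb (\<lambda>_. c) {v}" using c vc by (simp add: K.NC.lincomb_def)
      hence "x \<in> K.NC.span {v}" unfolding K.NC.span_def by blast
      thus "x \<in> K.span {v}" using K.span_same[of "{v}"] v by auto
    qed
  qed
  from K.Ker.dim1I[OF this] show ?thesis using v by simp
qed


lemma pow_mat_mult_vec_carrier [simp]: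
  "A \<in> carrier_mat n n \<Longrightarrow> x \<in> carrier_vec n \<Longrightarrow> A ^\<^sub>m k *\<^sub>v x \<in> carrier_vec n"
  by (metis mult_mat_vec_carrier pow_carrier_mat)

section \<open>Inner product identities\<close>

lemma pow_adjoint_cscalar_prod:
  fixes A :: "complex mat"
  assumes A: "A \<in> carrier_mat n n" and x: "x \<in> carrier_vec n" and y: "y \<in> carrier_vec n"
  shows "(A ^\<^sub>m k *\<^sub>v x) \<bullet>c y = x \<bullet>c (mat_adjoint A ^\<^sub>m k *\<^sub>v y)"
  using x
proof (induct k arbitrary: x)
  case 0
  have "dim_row (mat_adjoint A) = n" using mat_adjoint_carrier[OF A] by auto
  thus ?case using A y 0 by simp
next
  case (Suc k)
  have H: "mat_adjoint A \<in> carrier_mat n n" using A by simp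
  have Ax: "A *\<^sub>v x \<in> carrier_vec n" using A Suc(2) by simp
  have "(A ^\<^sub>m Suc k *\<^sub>v x) \<bullet>c y = (A *\<^sub>v x) \<bullet>c (mat_adjoint A ^\<^sub>m k *\<^sub>v y)"
    unfolding pow_mat_mult_vec[OF A Suc(2)] by (rule Suc(1)[OF Ax])
  also have "\<dots> = x \<bullet>c (mat_adjoint A *\<^sub>v (mat_adjoint A ^\<^sub>m k *\<^sub>v y))"
    by (rule adjoint_cscalar_prod[OF A Suc(2)]) (use H y in simp)
  also have "mat_adjoint A *\<^sub>v (mat_adjoint A ^\<^sub>m k *\<^sub>v y) = mat_adjoint A ^\<^sub>m Suc k *\<^sub>v y"
    by (rule pow_mat_mult_vec_left[OF H y, symmetric])
  finally show ?case .
qed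

lemma cscalar_prod_minus_smult_left:
  fixes x y z :: "complex vec"
  assumes "x \<in> carrier_vec n" "y \<in> carrier_vec n" "z \<in> carrier_vec n"
  shows "(x - c \<cdot>\<^sub>v y) \<bullet>c z = x \<bullet>c z - c * (y \<bullet>c z)"
  using assms by (simp add: minus_scalar_prod_distrib[of _ n])

lemma cscalar_prod_minus_smult_right:
  fixes x y z :: "complex vec"
  assumes "x \<in> carrier_vec n" "y \<in> carrier_vec n" "z \<in> carrier_vec n"
  shows "x \<bullet>c (y - c \<cdot>\<^sub>v z) = x \<bullet>c y - cnj c * (x \<bullet>c z)"
proof -
  have "conjugate (y - c \<cdot>\<^sub>v z) = conjugate y - cnj c \<cdot>\<^sub>v conjugate z"
    using assms by (intro eq_vecI) auto
  thus ?thesis using assms by (simp add: scalar_prod_minus_distrib[of _ n])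
qed

lemma cscalar_prod_commute:
  fixes x y :: "complex vec"
  assumes "x \<in> carrier_vec n" "y \<in> carrier_vec n"
  shows "y \<bullet>c x = cnj (x \<bullet>c y)"
  using assms by (auto simp: scalar_prod_def mult.commute intro!: sum.cong)

lemma vec_norm_eq_0_iff:
  assumes "x \<in> carrier_vec n"
  shows "vec_norm x = 0 \<longleftrightarrow> x = 0\<^sub>v n"
  using conjugate_square_eq_0_vec[OF assms] cscalar_prod_self[of x] by auto

lemma mult_mat_vec_minus_smult:
  fixes A :: "complex mat"
  assumes A: "A \<in> carrier_mat n n" and x: "x \<in> carrier_vec n" and y: "y \<in> carrier_vec n"
  shows "A *\<^sub>v (x - c \<cdot>\<^sub>v y) = A *\<^sub>v x - c \<cdot>\<^sub>v (A *\<^sub>v y)"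
  using assms by (simp add: mult_minus_distrib_mat_vec[of _ n n] mult_mat_vec[of _ n n])

lemma kernel_perp_eq:
  "M \<in> carrier_mat n n \<Longrightarrow>
    kernel_perp M = {x \<in> carrier_vec n. \<forall>y \<in> mat_kernel M. x \<bullet>c y = 0}"
  unfolding kernel_perp_def by auto

section \<open>Matrices whose defect I - A*A projects onto the kernel\<close>

text \<open>Isolates what rank one and noninvertibility provide. The bound on the eigenvalues is
  kept out and enters only later, through \<open>no_isometric\<close>.\<close>

locale kernel_defect =
  fixes n :: nat and A :: "complex mat" and v :: "complex vec"
  assumes A: "A \<in> carrier_mat n n"
    and v: "v \<in> carrier_vec n"
    and v_unit: "v \<bullet>c v = 1"
    and v_kernel: "A *\<^sub>v v = 0\<^sub>v n"
    and defect: "\<And>x. x \<in> carrier_vec n \<Longrightarrow> mat_adjoint A *\<^sub>v (A *\<^sub>v x) = x - (x \<bullet>c v) \<cdot>\<^sub>v v"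
begin

text \<open>Powers of the adjoint let products with \<open>e i\<close> be read off from the orbit of
  the other vector, as in \<open>cscalar_prod_e\<close>. All indices are allowed, although only an
  initial segment will be shown to be a Jordan chain.\<close>

definition e :: "nat \<Rightarrow> complex vec" where
  "e i = mat_adjoint A ^\<^sub>m i *\<^sub>v v"

lemma A_carrier [simp]: "x \<in> carrier_vec n \<Longrightarrow> A *\<^sub>v x \<in> carrier_vec n"
  using A by simp

lemma pow_carrier [simp]: "x \<in> carrier_vec n \<Longrightarrow> A ^\<^sub>m k *\<^sub>v x \<in> carrier_vec n"
  using A by simp

lemma adj: "mat_adjoint A \<in> carrier_mat n n"
  using A by simp

lemma e_carrier [simp]: "e i \<in> carrier_vec n"
  unfolding e_def using adj v by simp

lemma e_0: "e 0 = v"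
  unfolding e_def using v carrier_matD(1)[OF adj] by simp

lemma e_Suc: "e (Suc i) = mat_adjoint A *\<^sub>v e i"
  unfolding e_def by (rule pow_mat_mult_vec_left[OF adj v])

lemma cscalar_prod_e: "x \<in> carrier_vec n \<Longrightarrow> x \<bullet>c e i = (A ^\<^sub>m i *\<^sub>v x) \<bullet>c v"
  unfolding e_def using pow_adjoint_cscalar_prod[OF A _ v] by simp

lemma kernel_span:
  assumes x: "x \<in> carrier_vec n" and Ax: "A *\<^sub>v x = 0\<^sub>v n"
  shows "x = (x \<bullet>c v) \<cdot>\<^sub>v v"
proof -
  have "x - (x \<bullet>c v) \<cdot>\<^sub>v v = 0\<^sub>v n"
    using defect[OF x] mult_mat_zero_vec[OF adj] unfolding Ax by simp
  hence "x = x - (x - (x \<bullet>c v) \<cdot>\<^sub>v v)" using x by simp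
  also have "\<dots> = (x \<bullet>c v) \<cdot>\<^sub>v v" using x v by (intro eq_vecI) auto
  finally show ?thesis .
qed

lemma kernel_dim_A: "kernel_dim A = 1"
proof (rule kernel_dim_singleton[OF A])
  show "v \<in> mat_kernel A" by (rule mat_kernelI[OF A v v_kernel])
  show "v \<noteq> 0\<^sub>v n" using v_unit by auto
  show "\<exists>c. x = c \<cdot>\<^sub>v v" if "x \<in> mat_kernel A" for x
    using mat_kernelD[OF A that] kernel_span by blast
qed

text \<open>The correction term in \<open>defect\<close> is a multiple of \<open>v\<close>, which
  \<open>A\<close> kills. Thus the adjoint picks preimages: A(A*y) = y for y in the range of
  \<open>A\<close>.\<close>

lemma A_adjoint_A:
  assumes x: "x \<in> carrier_vec n"
  shows "A *\<^sub>v (mat_adjoint A *\<^sub>v (A *\<^sub>v x)) = A *\<^sub>v x"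
  unfolding defect[OF x] mult_mat_vec_minus_smult[OF A x v] v_kernel using A x by auto

lemma vec_norm_A:
  assumes x: "x \<in> carrier_vec n"
  shows "(vec_norm (A *\<^sub>v x))\<^sup>2 = (vec_norm x)\<^sup>2 - (cmod (x \<bullet>c v))\<^sup>2"
proof -
  have "(A *\<^sub>v x) \<bullet>c (A *\<^sub>v x) = x \<bullet>c x - cnj (x \<bullet>c v) * (x \<bullet>c v)"
    unfolding adjoint_cscalar_prod[OF A x A_carrier[OF x]] defect[OF x]
    by (rule cscalar_prod_minus_smult_right[OF x x v])
  also have "cnj (x \<bullet>c v) * (x \<bullet>c v) = complex_of_real ((cmod (x \<bullet>c v))\<^sup>2)"
    by (subst complex_norm_square) simp
  finally have "complex_of_real ((vec_norm (A *\<^sub>v x))\<^sup>2)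
      = complex_of_real ((vec_norm x)\<^sup>2 - (cmod (x \<bullet>c v))\<^sup>2)"
    unfolding cscalar_prod_self by simp
  thus ?thesis unfolding of_real_eq_iff .
qed

text \<open>Telescoping: \<open>vec_norm_A\<close> at the vector A^k x loses the square of |<A^k x,
  v>|, and this inner product equals <x, e_k>.\<close>

lemma vec_norm_pow:
  assumes x: "x \<in> carrier_vec n"
  shows "(vec_norm (A ^\<^sub>m k *\<^sub>v x))\<^sup>2 = (vec_norm x)\<^sup>2 - (\<Sum>i<k. (cmod (x \<bullet>c e i))\<^sup>2)"
proof (induct k)
  case 0 thus ?case using A x by simp
next
  case (Suc k)
  thus ?case unfolding pow_mat_mult_vec_left[OF A x]
    using vec_norm_A[of "A ^\<^sub>m k *\<^sub>v x"] cscalar_prod_e[OF x, of k] x by simp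
qed

lemma vec_norm_pow_eq_iff:
  assumes x: "x \<in> carrier_vec n"
  shows "vec_norm (A ^\<^sub>m k *\<^sub>v x) = vec_norm x \<longleftrightarrow> (\<forall>i<k. x \<bullet>c e i = 0)"
proof -
  have "vec_norm (A ^\<^sub>m k *\<^sub>v x) = vec_norm x \<longleftrightarrow> (vec_norm (A ^\<^sub>m k *\<^sub>v x))\<^sup>2 = (vec_norm x)\<^sup>2"
    by (simp add: vec_norm_ge_0)
  also have "\<dots> \<longleftrightarrow> (\<Sum>i<k. (cmod (x \<bullet>c e i))\<^sup>2) = 0"
    unfolding vec_norm_pow[OF x] by simp
  also have "\<dots> \<longleftrightarrow> (\<forall>i<k. x \<bullet>c e i = 0)"
    by (subst sum_nonneg_eq_0_iff) auto
  finally show ?thesis .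
qed

end

section \<open>The orthonormal Jordan chain\<close>

text \<open>The vector \<open>w\<close> witnesses that the kernels still grow from exponent b to b +
  1. In the application b + 1 is the ascent.\<close>

locale kernel_chain = kernel_defect +
  fixes b :: nat and w :: "complex vec"
  assumes w: "w \<in> carrier_vec n"
    and w_top: "A ^\<^sub>m b *\<^sub>v w \<noteq> 0\<^sub>v n"
    and w_kernel: "A ^\<^sub>m Suc b *\<^sub>v w = 0\<^sub>v n"
begin

text \<open>Since ker A is a line, it is spanned by A^b w. Subtracting from x a suitable multiple of
  an element of the range therefore lowers the exponent that annihilates x, and induction
  finishes.\<close>

lemma kernel_pow_in_range:
  assumes "i \<le> b" "x \<in> carrier_vec n" "A ^\<^sub>m i *\<^sub>v x = 0\<^sub>v n"
  shows "\<exists>y\<in>carrier_vec n. x = A *\<^sub>v y"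
  using assms
proof (induct i arbitrary: x)
  case 0
  hence "x = A *\<^sub>v 0\<^sub>v n" using A by (simp add: mult_mat_zero_vec)
  thus ?case by (intro bexI[of _ "0\<^sub>v n"]) auto
next
  case (Suc i)
  define t where "t = A ^\<^sub>m b *\<^sub>v w"
  define u where "u = A ^\<^sub>m (b - Suc i) *\<^sub>v w"
  have t: "t \<in> carrier_vec n" and u: "u \<in> carrier_vec n" unfolding t_def u_def using w by auto
  have "A *\<^sub>v t = 0\<^sub>v n" unfolding t_def using w_kernel pow_mat_mult_vec_left[OF A w] by simp
  from kernel_span[OF t this] have tv: "t = (t \<bullet>c v) \<cdot>\<^sub>v v" .
  have tv0: "t \<bullet>c v \<noteq> 0"
  proof
    assume "t \<bullet>c v = 0"
    hence "t = 0\<^sub>v n" using tv v by auto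
    thus False using w_top unfolding t_def by simp
  qed
  have Ax: "A ^\<^sub>m i *\<^sub>v x \<in> carrier_vec n" using Suc by simp
  have "A *\<^sub>v (A ^\<^sub>m i *\<^sub>v x) = 0\<^sub>v n" using Suc(4) pow_mat_mult_vec_left[OF A Suc(3)] by simp
  from kernel_span[OF Ax this] obtain c where c: "A ^\<^sub>m i *\<^sub>v x = c \<cdot>\<^sub>v v" by blast
  \<comment> \<open>With this coefficient, d t equals A^i x, so A^i annihilates the difference x - d
    (A u).\<close>
  define d where "d = c / (t \<bullet>c v)"
  \<comment> \<open>The exponents add up to b because \<open>Suc i \<le> b\<close>; truncated
    subtraction does no harm.\<close>
  have "A ^\<^sub>m i *\<^sub>v (A *\<^sub>v u) = A ^\<^sub>m (i + Suc (b - Suc i)) *\<^sub>v w"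
    unfolding u_def pow_mat_add_mult_vec[OF A w] pow_mat_mult_vec_left[OF A w] ..
  also have "\<dots> = t" unfolding t_def using Suc(2) by simp
  finally have Au: "A ^\<^sub>m i *\<^sub>v (A *\<^sub>v u) = t" .
  have "A ^\<^sub>m i *\<^sub>v (x - d \<cdot>\<^sub>v (A *\<^sub>v u)) = c \<cdot>\<^sub>v v - d \<cdot>\<^sub>v t"
    using mult_mat_vec_minus_smult[OF pow_carrier_mat[OF A, of i] Suc(3) A_carrier[OF u], of d]
    unfolding Au c .
  also have "\<dots> = c \<cdot>\<^sub>v v - d \<cdot>\<^sub>v ((t \<bullet>c v) \<cdot>\<^sub>v v)" by (subst tv) simp
  also have "\<dots> = 0\<^sub>v n" unfolding d_def using v tv0 by (intro eq_vecI) auto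
  finally have "A ^\<^sub>m i *\<^sub>v (x - d \<cdot>\<^sub>v (A *\<^sub>v u)) = 0\<^sub>v n" .
  from Suc(1)[OF _ _ this] Suc(2,3) u obtain y where
    y: "y \<in> carrier_vec n" and xy: "x - d \<cdot>\<^sub>v (A *\<^sub>v u) = A *\<^sub>v y" by auto
  have "x = (x - d \<cdot>\<^sub>v (A *\<^sub>v u)) + d \<cdot>\<^sub>v (A *\<^sub>v u)"
    using Suc(3) A u by (intro eq_vecI) auto
  also have "\<dots> = A *\<^sub>v (y + d \<cdot>\<^sub>v u)"
    unfolding xy using A u y by (simp add: mult_add_distrib_mat_vec[of _ n n] mult_mat_vec[of _ n n])
  finally show ?case using y u by (intro bexI[of _ "y + d \<cdot>\<^sub>v u"]) auto
qed

text \<open>The two claims feed each other: e_i in ker A^(i+1) puts e_i in the range of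
  \<open>A\<close>, where the adjoint gives a preimage, so A e_(i+1) = e_i; this in turn places
  e_(i+1) in the next kernel.\<close>

lemma e_kernel: "i \<le> b \<Longrightarrow> A ^\<^sub>m Suc i *\<^sub>v e i = 0\<^sub>v n"
  and A_e_Suc: "Suc i \<le> b \<Longrightarrow> A *\<^sub>v e (Suc i) = e i"
proof -
  have step: "A *\<^sub>v e (Suc i) = e i" if i: "Suc i \<le> b" and 0: "A ^\<^sub>m Suc i *\<^sub>v e i = 0\<^sub>v n" for i
  proof -
    from kernel_pow_in_range[OF i e_carrier 0] obtain y where
      "y \<in> carrier_vec n" "e i = A *\<^sub>v y" by blast
    thus ?thesis unfolding e_Suc using A_adjoint_A by simp
  qed
  have ker: "i \<le> b \<Longrightarrow> A ^\<^sub>m Suc i *\<^sub>v e i = 0\<^sub>v n" for i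
  proof (induct i)
    case 0 thus ?case using A v_kernel e_0 by simp
  next
    case (Suc i)
    have "A ^\<^sub>m Suc i *\<^sub>v e i = 0\<^sub>v n" using Suc by simp
    with step[OF Suc(2) this] show ?case unfolding pow_mat_mult_vec[OF A e_carrier, of "Suc i"] by simp
  qed
  show "i \<le> b \<Longrightarrow> A ^\<^sub>m Suc i *\<^sub>v e i = 0\<^sub>v n" by (rule ker)
  show "Suc i \<le> b \<Longrightarrow> A *\<^sub>v e (Suc i) = e i" using ker step by simp
qed

lemma pow_e: "i \<le> b \<Longrightarrow> A ^\<^sub>m i *\<^sub>v e i = v"
proof (induct i)
  case 0 thus ?case using A v e_0 by simp
next
  case (Suc i) thus ?case unfolding pow_mat_mult_vec[OF A e_carrier] A_e_Suc[OF Suc(2)] by simp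
qed

lemma pow_e_eq_0: "i < j \<Longrightarrow> i \<le> b \<Longrightarrow> A ^\<^sub>m j *\<^sub>v e i = 0\<^sub>v n"
  using mat_kernel_pow_subset[OF A, of "Suc i" j] e_kernel[of i]
  unfolding subset_iff mem_mat_kernel_pow[OF A] by simp

text \<open><e_i, e_j> equals <A^j e_i, v>, and A^j e_i is \<open>v\<close> for i = j and 0 for i <
  j. Conjugate symmetry covers i > j.\<close>

lemma e_orthonormal:
  assumes "i \<le> b" "j \<le> b"
  shows "e i \<bullet>c e j = (if i = j then 1 else 0)"
proof -
  have lt: "e i \<bullet>c e j = 0" if "i < j" "i \<le> b" for i j
    unfolding cscalar_prod_e[OF e_carrier] pow_e_eq_0[OF that] using v by simp
  have "e i \<bullet>c e i = 1"
    unfolding cscalar_prod_e[OF e_carrier] pow_e[OF assms(1)] by (rule v_unit)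
  moreover have "e i \<bullet>c e j = 0" if "j < i"
    using lt[OF that assms(2)] cscalar_prod_commute[of "e j" n "e i"] by simp
  ultimately show ?thesis using lt[of i j] assms by (cases i j rule: linorder_cases) auto
qed

text \<open>In effect e_0, ..., e_(j-1) span ker A^j: if A^(j+1) y = 0, then A^j y = c v = A^j (c
  e_j), so y - c e_j lies in ker A^j.\<close>

lemma perp_kernel_pow:
  assumes "j \<le> Suc b" "x \<in> carrier_vec n" "\<forall>i<j. x \<bullet>c e i = 0"
    and "y \<in> carrier_vec n" "A ^\<^sub>m j *\<^sub>v y = 0\<^sub>v n"
  shows "x \<bullet>c y = 0"
  using assms
proof (induct j arbitrary: y)
  case 0 thus ?case using A by simp
next
  case (Suc j)
  have "A *\<^sub>v (A ^\<^sub>m j *\<^sub>v y) = 0\<^sub>v n" using Suc(6) pow_mat_mult_vec_left[OF A Suc(5)] by simp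
  from kernel_span[OF pow_carrier[OF Suc(5)] this] obtain c where
    c: "A ^\<^sub>m j *\<^sub>v y = c \<cdot>\<^sub>v v" by blast
  have "A ^\<^sub>m j *\<^sub>v (y - c \<cdot>\<^sub>v e j) = 0\<^sub>v n"
    unfolding mult_mat_vec_minus_smult[OF pow_carrier_mat[OF A] Suc(5) e_carrier] c
    using pow_e[of j] Suc(2) v by simp
  hence "x \<bullet>c (y - c \<cdot>\<^sub>v e j) = 0" using Suc by simp
  thus ?case unfolding cscalar_prod_minus_smult_right[OF Suc(3,5) e_carrier] using Suc(4) by simp
qed

lemma kernel_perp_pow:
  assumes "j \<le> Suc b"
  shows "kernel_perp (A ^\<^sub>m j) = {x \<in> carrier_vec n. \<forall>i<j. x \<bullet>c e i = 0}"
  unfolding kernel_perp_eq[OF pow_carrier_mat[OF A]] using perp_kernel_pow[OF assms] assms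
  by (auto simp: mem_mat_kernel_pow[OF A] pow_e_eq_0)

text \<open>On the complement of the kernel, every term of the norm loss in
  \<open>vec_norm_pow\<close> vanishes.\<close>

lemma partial_isometry_pow: "j \<le> Suc b \<Longrightarrow> partial_isometry (A ^\<^sub>m j)"
  unfolding partial_isometry_def kernel_perp_pow by (simp add: vec_norm_pow_eq_iff)

text \<open>Because the kernels have stabilised, A^(b+2) has the same kernel complement as A^(b+1).
  Being isometric there makes this complement invariant under \<open>A\<close>, so \<open>A\<close>
  preserves norms along the whole orbit of x.\<close>

lemma perp_e_eq_0:
  assumes stable: "mat_kernel (A ^\<^sub>m Suc (Suc b)) = mat_kernel (A ^\<^sub>m Suc b)"
    and pi: "partial_isometry (A ^\<^sub>m Suc (Suc b))"
    and no_isometric: "\<And>x. x \<in> carrier_vec n \<Longrightarrow> (\<And>k. vec_norm (A ^\<^sub>m k *\<^sub>v x) = vec_norm x) \<Longrightarrow> x = 0\<^sub>v n"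
    and x: "x \<in> carrier_vec n" and perp: "\<forall>i<Suc b. x \<bullet>c e i = 0"
  shows "x = 0\<^sub>v n"
proof (rule no_isometric[OF x])
  have perp_eq: "kernel_perp (A ^\<^sub>m Suc (Suc b)) = {x \<in> carrier_vec n. \<forall>i<Suc b. x \<bullet>c e i = 0}"
    using kernel_perp_pow[of "Suc b"] stable
    unfolding kernel_perp_eq[OF pow_carrier_mat[OF A]] by simp
  have step: "\<forall>i<Suc b. (A *\<^sub>v z) \<bullet>c e i = 0"
    if z: "z \<in> carrier_vec n" and "\<forall>i<Suc b. z \<bullet>c e i = 0" for z
  proof -
    have "vec_norm (A ^\<^sub>m Suc (Suc b) *\<^sub>v z) = vec_norm z"
      using pi that unfolding partial_isometry_def perp_eq by blast
    \<comment> \<open>Isometry of A^(b+2) yields orthogonality up to index b + 1, one more than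
      assumed; this is what <A z, e_i> = <z, e_(i+1)> requires at i = b.\<close>
    hence "z \<bullet>c e (Suc i) = 0" if "i < Suc b" for i
      using that unfolding vec_norm_pow_eq_iff[OF z] by simp
    thus ?thesis using z
      by (simp add: cscalar_prod_e pow_mat_mult_vec[OF A z, symmetric] del: pow_mat.simps)
  qed
  have all: "\<forall>i<Suc b. (A ^\<^sub>m k *\<^sub>v x) \<bullet>c e i = 0" for k
  proof (induct k)
    case 0 thus ?case using perp A x by simp
  next
    case (Suc k)
    show ?case unfolding pow_mat_mult_vec_left[OF A x] by (rule step[OF pow_carrier[OF x] Suc])
  qed
  fix k
  \<comment> \<open>Here i is unrestricted: orthogonality of the orbit to e_0 = \<open>v\<close>
    alone reaches indices beyond the chain.\<close>
  have "x \<bullet>c e i = 0" for i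
  proof -
    have "(A ^\<^sub>m i *\<^sub>v x) \<bullet>c e 0 = 0" using all[of i] by simp
    thus ?thesis unfolding cscalar_prod_e[OF x] e_0 .
  qed
  thus "vec_norm (A ^\<^sub>m k *\<^sub>v x) = vec_norm x" unfolding vec_norm_pow_eq_iff[OF x] by simp
qed

text \<open>Gram-Schmidt, one chain vector at a time; every e_i used lies in ker A^(b+1), so the
  correction stays there.\<close>

lemma kernel_projection:
  assumes x: "x \<in> carrier_vec n" and "j \<le> Suc b"
  shows "\<exists>k\<in>carrier_vec n. A ^\<^sub>m Suc b *\<^sub>v k = 0\<^sub>v n \<and> (\<forall>i<j. (x - k) \<bullet>c e i = 0)"
  using assms(2)
proof (induct j)
  case 0
  show ?case by (rule bexI[of _ "0\<^sub>v n"]) (use mult_mat_zero_vec[OF pow_carrier_mat[OF A], of "Suc b"] in auto)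
next
  case (Suc j)
  then obtain k where k: "k \<in> carrier_vec n" and k0: "A ^\<^sub>m Suc b *\<^sub>v k = 0\<^sub>v n"
    and perp: "\<forall>i<j. (x - k) \<bullet>c e i = 0" by auto
  define c where "c = (x - k) \<bullet>c e j"
  \<comment> \<open>This is k + c e_j, written as a difference to fit
    \<open>mult_mat_vec_minus_smult\<close>.\<close>
  define k' where "k' = k - (- c) \<cdot>\<^sub>v e j"
  have k': "k' \<in> carrier_vec n" unfolding k'_def using k by simp
  have jb: "j \<le> b" using Suc(2) by simp
  have "A ^\<^sub>m Suc b *\<^sub>v k' = 0\<^sub>v n"
    unfolding k'_def mult_mat_vec_minus_smult[OF pow_carrier_mat[OF A] k e_carrier] k0
    using pow_e_eq_0[of j "Suc b"] jb by auto
  moreover have "(x - k') \<bullet>c e i = 0" if i: "i < Suc j" for i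
  proof -
    have "x - k' = (x - k) - c \<cdot>\<^sub>v e j"
      unfolding k'_def using x k by (intro eq_vecI) (auto simp: carrier_vecD[OF e_carrier])
    hence "(x - k') \<bullet>c e i = (x - k) \<bullet>c e i - c * (e j \<bullet>c e i)"
      using cscalar_prod_minus_smult_left[of "x - k" n "e j" "e i" c] x k by simp
    also have "\<dots> = 0"
      using e_orthonormal[OF jb, of i] i jb perp unfolding c_def by (cases "i = j") auto
    finally show ?thesis .
  qed
  ultimately show ?case using k' by blast
qed

lemma nilpotent:
  assumes "\<And>x. x \<in> carrier_vec n \<Longrightarrow> \<forall>i<Suc b. x \<bullet>c e i = 0 \<Longrightarrow> x = 0\<^sub>v n"
    and x: "x \<in> carrier_vec n"
  shows "A ^\<^sub>m Suc b *\<^sub>v x = 0\<^sub>v n"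
proof -
  obtain k where k: "k \<in> carrier_vec n" and k0: "A ^\<^sub>m Suc b *\<^sub>v k = 0\<^sub>v n"
    and perp: "\<forall>i<Suc b. (x - k) \<bullet>c e i = 0" using kernel_projection[OF x] by blast
  have "x - k = 0\<^sub>v n" using assms(1)[OF _ perp] x k by simp
  have "x = (x - k) + k" using x k by (intro eq_vecI) auto
  hence "x = k" using \<open>x - k = 0\<^sub>v n\<close> k by simp
  thus ?thesis using k0 by simp
qed

text \<open>With n = b + 1 the chain is an orthonormal basis, so the matrix with columns e_i is
  unitary. The relations A e_0 = 0 and A e_(i+1) = e_i are A U = U J column by column.\<close>

lemma unitarily_similar_jordan_block:
  assumes n: "n = Suc b"
  shows "unitarily_similar A (jordan_block n 0)"
proof -
  define U where "U = mat_of_cols n (map e [0..<n])"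
  have U: "U \<in> carrier_mat n n" unfolding U_def by auto
  have colU: "col U i = e i" if "i < n" for i
    unfolding U_def using that by (simp add: col_mat_of_cols)
  let ?V = "mat_adjoint U"
  let ?J = "jordan_block n (0 :: complex)"
  have V: "?V \<in> carrier_mat n n" using U by simp
  have J: "?J \<in> carrier_mat n n" by simp
  have VU: "?V * U = 1\<^sub>m n"
  proof (rule eq_matI)
    fix i j assume ij: "i < dim_row (1\<^sub>m n :: complex mat)" "j < dim_col (1\<^sub>m n :: complex mat)"
    have "row ?V i = conjugate (e i)"
      unfolding mat_adjoint_def using ij U colU by (simp add: cols_nth)
    moreover have "(?V * U) $$ (i,j) = row ?V i \<bullet> col U j"
      by (rule index_mult_mat(1)) (use ij carrier_matD[OF V] U in auto)
    ultimately have "(?V * U) $$ (i,j) = conjugate (e i) \<bullet> e j"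
      using ij colU by simp
    also have "\<dots> = e j \<bullet>c e i"
      using conjugate_vec_sprod_comm[of "e j" n "e i"] by simp
    also have "\<dots> = 1\<^sub>m n $$ (i,j)" using ij n e_orthonormal[of j i] by auto
    finally show "(?V * U) $$ (i,j) = 1\<^sub>m n $$ (i,j)" .
  qed (use U carrier_matD[OF V] in auto)
  have UV: "U * ?V = 1\<^sub>m n" by (rule mat_mult_left_right_inverse[OF V U VU])
  have AU: "A * U = U * ?J"
  proof (rule mat_col_eqI)
    fix j assume "j < dim_col (U * ?J)"
    hence j: "j < n" by simp
    have L: "col (A * U) j = A *\<^sub>v e j" using col_mult2[OF A U j] colU[OF j] by simp
    have R: "col (U * ?J) j = U *\<^sub>v col ?J j" using col_mult2[OF U J j] .
    show "col (A * U) j = col (U * ?J) j"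
    proof (cases j)
      case 0
      have "col ?J j = 0\<^sub>v n" using j 0 by (intro eq_vecI) auto
      thus ?thesis unfolding L R using 0 e_0 v_kernel mult_mat_zero_vec[OF U] by simp
    next
      case (Suc i)
      have "col ?J j = unit_vec n i" using j Suc by (intro eq_vecI) (auto simp: unit_vec_def)
      hence "U *\<^sub>v col ?J j = e i" using colU[of i, symmetric] U j Suc by (intro eq_vecI) auto
      thus ?thesis unfolding L R using A_e_Suc[of i] j n Suc by simp
    qed
  qed (use A U in auto)
  have "A = A * (U * ?V)" unfolding UV using A by simp
  also have "\<dots> = U * ?J * ?V" unfolding AU[symmetric] by (rule assoc_mult_mat[OF A U V, symmetric])
  finally have "similar_mat_wit A ?J U ?V"
    by (intro similar_mat_witI[OF UV VU _ A J U V])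
  thus ?thesis unfolding unitarily_similar_def by blast
qed

end

section \<open>Spectral radius below 1 excludes isometric orbits\<close>

lemma eigenvalue_smultD:
  fixes A :: "'a :: field mat"
  assumes A: "A \<in> carrier_mat n n" and c: "c \<noteq> 0" and ev: "eigenvalue (c \<cdot>\<^sub>m A) z"
  shows "eigenvalue A (z / c)"
proof -
  obtain u where u: "u \<in> carrier_vec n" "u \<noteq> 0\<^sub>v n" and eq: "(c \<cdot>\<^sub>m A) *\<^sub>v u = z \<cdot>\<^sub>v u"
    using ev A unfolding eigenvalue_def eigenvector_def by auto
  have "A *\<^sub>v u = (1 / c) \<cdot>\<^sub>v (c \<cdot>\<^sub>v (A *\<^sub>v u))" using c A u by (intro eq_vecI) auto
  also have "c \<cdot>\<^sub>v (A *\<^sub>v u) = (c \<cdot>\<^sub>m A) *\<^sub>v u" using A u by (intro eq_vecI) auto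
  also have "(1 / c) \<cdot>\<^sub>v \<dots> = (z / c) \<cdot>\<^sub>v u" unfolding eq using u by (intro eq_vecI) auto
  finally show ?thesis using u A unfolding eigenvalue_def eigenvector_def by auto
qed

lemma pow_smult_mult_vec:
  fixes A :: "'a :: field mat"
  assumes A: "A \<in> carrier_mat n n" and x: "x \<in> carrier_vec n"
  shows "(c \<cdot>\<^sub>m A) ^\<^sub>m k *\<^sub>v x = c ^ k \<cdot>\<^sub>v (A ^\<^sub>m k *\<^sub>v x)"
proof (induct k)
  case 0 thus ?case using A x by simp
next
  case (Suc k)
  have cA: "c \<cdot>\<^sub>m A \<in> carrier_mat n n" using A by simp
  have y: "A ^\<^sub>m k *\<^sub>v x \<in> carrier_vec n" using A x by simp
  show ?case unfolding pow_mat_mult_vec_left[OF cA x] pow_mat_mult_vec_left[OF A x] Suc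
    using A y by (intro eq_vecI) (auto simp: ac_simps mult_mat_vec[of _ n n] scalar_prod_smult_right)
qed

text \<open>A crude estimate suffices: it is applied to all powers of one matrix with a common entry
  bound \<open>c\<close>.\<close>

lemma vec_norm_mult_le:
  assumes M: "M \<in> carrier_mat n n" and x: "x \<in> carrier_vec n" and c: "norm_bound M c"
  shows "(vec_norm (M *\<^sub>v x))\<^sup>2 \<le> real n * (c * (\<Sum>j<n. cmod (x $ j)))\<^sup>2"
proof -
  have entry: "cmod ((M *\<^sub>v x) $ i) \<le> c * (\<Sum>j<n. cmod (x $ j))" if i: "i < n" for i
  proof -
    have "(M *\<^sub>v x) $ i = (\<Sum>j<n. M $$ (i,j) * x $ j)"
      using M x i by (auto simp: scalar_prod_def atLeast0LessThan)
    also have "cmod \<dots> \<le> (\<Sum>j<n. c * cmod (x $ j))"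
      using c M i unfolding norm_bound_def
      by (intro sum_norm_le) (auto simp: norm_mult intro!: mult_right_mono)
    finally show ?thesis by (simp add: sum_distrib_left)
  qed
  have "(vec_norm (M *\<^sub>v x))\<^sup>2 = (\<Sum>i<n. (cmod ((M *\<^sub>v x) $ i))\<^sup>2)"
    unfolding vec_norm_def using M by (simp add: sum_nonneg)
  also have "\<dots> \<le> (\<Sum>i<n. (c * (\<Sum>j<n. cmod (x $ j)))\<^sup>2)"
    by (intro sum_mono power_mono entry) auto
  finally show ?thesis by simp
qed

lemma vec_norm_smult: "vec_norm (c \<cdot>\<^sub>v x) = cmod c * vec_norm x"
  unfolding vec_norm_def
  by (simp add: norm_mult power_mult_distrib sum_distrib_left[symmetric] real_sqrt_mult)

text \<open>Scaling \<open>A\<close> by some t > 1 can keep the spectral radius below 1, so the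
  powers of the scaled matrix stay bounded. On x they would have norm t^k times that of x, which is
  unbounded unless x = 0.\<close>

lemma no_isometric_vector:
  fixes A :: "complex mat"
  assumes A: "A \<in> carrier_mat n n" and ev: "\<And>z. eigenvalue A z \<Longrightarrow> cmod z < 1"
    and x: "x \<in> carrier_vec n" and iso: "\<And>k. vec_norm (A ^\<^sub>m k *\<^sub>v x) = vec_norm x"
  shows "x = 0\<^sub>v n"
proof (rule ccontr)
  assume x0: "x \<noteq> 0\<^sub>v n"
  hence n: "n > 0" using x by (cases n) auto
  define r where "r = spectral_radius A"
  have r: "r < 1" "0 \<le> r" using spectral_radius_mem_max(1)[OF A n] ev
    unfolding r_def spectrum_def by auto
  \<comment> \<open>Since 0 \<le> r < 1, this t exceeds 1 while t r = 2r / (1 + r) is below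
    1.\<close>
  define t where "t = 2 / (1 + r)"
  have t: "t > 1" "t > 0" and tr: "t * r < 1" unfolding t_def using r by (auto simp: field_simps)
  let ?B = "complex_of_real t \<cdot>\<^sub>m A"
  have B: "?B \<in> carrier_mat n n" using A by simp
  have "spectral_radius ?B < 1"
  proof -
    obtain z where z: "eigenvalue ?B z" "spectral_radius ?B = cmod z"
      using spectral_radius_mem_max(1)[OF B n] unfolding spectrum_def by auto
    have "eigenvalue A (z / t)" using eigenvalue_smultD[OF A _ z(1)] t by simp
    hence "cmod (z / t) \<le> r" unfolding r_def
      by (intro spectral_radius_mem_max(2)[OF A n]) (auto simp: spectrum_def)
    hence "cmod z \<le> t * r" using t by (simp add: norm_divide field_simps)
    thus ?thesis using z tr by simp
  qed
  from spectral_radius_jnf_norm_bound_less_1_upper_triangular[OF B this] obtain c where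
    c: "\<And>k. norm_bound (?B ^\<^sub>m k) c" by auto
  define C where "C = real n * (c * (\<Sum>j<n. cmod (x $ j)))\<^sup>2"
  have bound: "(t ^ k * vec_norm x)\<^sup>2 \<le> C" for k
  proof -
    have "vec_norm (?B ^\<^sub>m k *\<^sub>v x) = t ^ k * vec_norm x"
      unfolding pow_smult_mult_vec[OF A x] vec_norm_smult iso using t by (simp add: norm_power)
    thus ?thesis using vec_norm_mult_le[OF pow_carrier_mat[OF B] x c, of k] unfolding C_def by simp
  qed
  have pos: "0 < vec_norm x" using vec_norm_eq_0_iff[OF x] x0 vec_norm_ge_0[of x] by simp
  obtain k where "(C + 1) / vec_norm x < t ^ k" using real_arch_pow[OF t(1)] by blast
  hence k: "C + 1 < t ^ k * vec_norm x" using pos by (simp add: field_simps)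
  have "0 \<le> C" unfolding C_def by simp
  \<comment> \<open>The bound controls a square, so C + 1 is compared with its own square, avoiding
    a root of C.\<close>
  hence "C + 1 \<le> (C + 1)\<^sup>2" by (simp add: power2_eq_square algebra_simps)
  also have "\<dots> \<le> (t ^ k * vec_norm x)\<^sup>2" using k \<open>0 \<le> C\<close> by (intro power_mono) auto
  finally show False using bound[of k] by simp
qed

section \<open>The index p(A) and nilpotent powers\<close>

lemma ppi_index_eq_infinity:
  assumes "\<And>j. partial_isometry (A ^\<^sub>m j)"
  shows "ppi_index A = \<infinity>"
proof (rule ccontr)
  assume "ppi_index A \<noteq> \<infinity>"
  then obtain m where m: "ppi_index A = enat m" by auto
  have "enat (Suc m) \<le> ppi_index A" unfolding ppi_index_def
    by (rule SUP_upper) (use assms in auto)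
  thus False unfolding m by simp
qed

lemma ppi_index_eq_enat:
  assumes "\<And>j. j \<le> m \<Longrightarrow> partial_isometry (A ^\<^sub>m j)" and "\<not> partial_isometry (A ^\<^sub>m Suc m)"
  shows "ppi_index A = enat m"
  unfolding ppi_index_def
proof (rule antisym)
  show "(SUP k\<in>{k. \<forall>j\<le>k. partial_isometry (A ^\<^sub>m j)}. enat k) \<le> enat m"
    by (rule SUP_least) (use assms(2) in \<open>auto simp del: pow_mat.simps intro!: leI simp flip: Suc_le_eq\<close>)
  show "enat m \<le> (SUP k\<in>{k. \<forall>j\<le>k. partial_isometry (A ^\<^sub>m j)}. enat k)"
    by (rule SUP_upper) (use assms(1) in auto)
qed

lemma partial_isometry_zero: "partial_isometry (0\<^sub>m n n)"
proof -
  have "x = 0\<^sub>v n" if "x \<in> kernel_perp (0\<^sub>m n n)" for x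
  proof -
    have x: "x \<in> carrier_vec n" and "\<forall>y\<in>mat_kernel (0\<^sub>m n n). x \<bullet>c y = 0"
      using that unfolding kernel_perp_def by auto
    moreover have "x \<in> mat_kernel (0\<^sub>m n n)" using x by (auto simp: mat_kernel[of _ n n])
    ultimately show ?thesis using conjugate_square_eq_0_vec[OF x] by blast
  qed
  moreover have "0\<^sub>m n n *\<^sub>v 0\<^sub>v n = (0\<^sub>v n :: complex vec)" by (rule mult_mat_zero_vec) simp
  ultimately show ?thesis unfolding partial_isometry_def by fastforce
qed

lemma unitarily_similar_jordan_block_pow:
  assumes "unitarily_similar A (jordan_block n 0)"
  shows "A ^\<^sub>m n = 0\<^sub>m n n"
proof -
  obtain U where wit: "similar_mat_wit A (jordan_block n 0) U (mat_adjoint U)"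
    using assms unfolding unitarily_similar_def by blast
  note wit_carrier = similar_mat_witD(5-7)[OF refl wit]
  have "dim_row A = n" using carrier_matD(1)[OF wit_carrier(1)] by simp
  with wit_carrier(2,3) have U: "U \<in> carrier_mat n n" "mat_adjoint U \<in> carrier_mat n n"
    by simp_all
  have "jordan_block n (0 :: complex) ^\<^sub>m n = 0\<^sub>m n n"
    unfolding jordan_block_zero_pow by (rule eq_matI) (simp_all, linarith)
  hence "A ^\<^sub>m n = U * 0\<^sub>m n n * mat_adjoint U"
    using similar_mat_wit_pow_id[OF wit, of n] by simp
  also have "\<dots> = 0\<^sub>m n n"
    using right_mult_zero_mat[OF U(1)] left_mult_zero_mat[OF U(2)] by simp
  finally show ?thesis .
qed

lemma eq_zero_matI:
  fixes M :: "'a :: field mat"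
  assumes M: "M \<in> carrier_mat n n" and "\<And>x. x \<in> carrier_vec n \<Longrightarrow> M *\<^sub>v x = 0\<^sub>v n"
  shows "M = 0\<^sub>m n n"
proof (rule eq_matI)
  fix i j assume "i < dim_row (0\<^sub>m n n :: 'a mat)" "j < dim_col (0\<^sub>m n n :: 'a mat)"
  hence ij: "i < n" "j < n" by auto
  have "M $$ (i,j) = (M *\<^sub>v unit_vec n j) $ i" using M ij by simp
  thus "M $$ (i,j) = 0\<^sub>m n n $$ (i,j)" using assms(2)[of "unit_vec n j"] ij by simp
qed (use M in auto)

section \<open>Noninvertible S_n-matrices\<close>

text \<open>A unit kernel vector \<open>v\<close> is fixed by B = I - A*A, so rank one gives B x = c
  v. Pairing with \<open>v\<close> and using that B is self-adjoint identifies c as <x, v>.\<close>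

lemma S_matrix_kernel_defect:
  assumes S: "S_matrix n A" and inv: "\<not> invertible_mat A"
  obtains v where "kernel_defect n A v"
proof -
  have A: "A \<in> carrier_mat n n"
    and rank: "vec_space.rank n (1\<^sub>m n - mat_adjoint A * A) = 1"
    using S unfolding S_matrix_def by auto
  let ?H = "mat_adjoint A"
  let ?B = "1\<^sub>m n - ?H * A"
  have H: "?H \<in> carrier_mat n n" using A by simp
  have HA: "?H * A \<in> carrier_mat n n" using mult_carrier_mat[OF H A] .
  have B: "?B \<in> carrier_mat n n" using HA by (auto intro: minus_carrier_mat)
  have Bx: "?B *\<^sub>v x = x - ?H *\<^sub>v (A *\<^sub>v x)" if "x \<in> carrier_vec n" for x
    using minus_mult_distrib_mat_vec[OF one_carrier_mat HA that] that A H by simp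
  have "det A = 0"
  proof (rule ccontr)
    assume "det A \<noteq> 0"
    from det_non_zero_imp_unit[OF A this, unfolded Units_def, of "()"] obtain C where
      "C \<in> carrier_mat n n" "C * A = 1\<^sub>m n" "A * C = 1\<^sub>m n" by (auto simp: ring_mat_def)
    thus False using inv A unfolding invertible_mat_def inverts_mat_def by auto
  qed
  then obtain u where u: "u \<in> carrier_vec n" "u \<noteq> 0\<^sub>v n" "A *\<^sub>v u = 0\<^sub>v n"
    unfolding det_0_iff_vec_prod_zero_field[OF A] by blast
  define s where "s = vec_norm u"
  have s: "s > 0" unfolding s_def using vec_norm_eq_0_iff[OF u(1)] u(2) vec_norm_ge_0[of u] by simp
  define v where "v = complex_of_real (1 / s) \<cdot>\<^sub>v u"
  have v: "v \<in> carrier_vec n" unfolding v_def using u by simp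
  have Av: "A *\<^sub>v v = 0\<^sub>v n" unfolding v_def mult_mat_vec[OF A u(1)] u(3) by auto
  have "vec_norm v = 1" unfolding v_def vec_norm_smult using s by (simp add: s_def norm_divide)
  hence vv: "v \<bullet>c v = 1" unfolding cscalar_prod_self by simp
  have v0: "v \<noteq> 0\<^sub>v n" using vv by auto
  have Bv: "?B *\<^sub>v v = v" unfolding Bx[OF v] Av mult_mat_zero_vec[OF H] using v by simp
  have selfadj: "(?B *\<^sub>v x) \<bullet>c v = x \<bullet>c v" if x: "x \<in> carrier_vec n" for x
  proof -
    have HAx: "?H *\<^sub>v (A *\<^sub>v x) \<in> carrier_vec n"
      by (rule mult_mat_vec_carrier[OF H mult_mat_vec_carrier[OF A x]])
    have "(?H *\<^sub>v (A *\<^sub>v x)) \<bullet>c v = cnj (v \<bullet>c (?H *\<^sub>v (A *\<^sub>v x)))"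
      by (rule cscalar_prod_commute[OF v HAx])
    also have "v \<bullet>c (?H *\<^sub>v (A *\<^sub>v x)) = (A *\<^sub>v v) \<bullet>c (A *\<^sub>v x)"
      by (rule adjoint_cscalar_prod[OF A v, symmetric]) (use A x in simp)
    also have "\<dots> = 0" unfolding Av using A x by simp
    finally have "(?H *\<^sub>v (A *\<^sub>v x)) \<bullet>c v = 0" by simp
    thus ?thesis unfolding Bx[OF x] using minus_scalar_prod_distrib[OF x HAx, of "conjugate v"] x v by simp
  qed
  have defect: "?H *\<^sub>v (A *\<^sub>v x) = x - (x \<bullet>c v) \<cdot>\<^sub>v v" if x: "x \<in> carrier_vec n" for x
  proof -
    obtain c where c: "?B *\<^sub>v x = c \<cdot>\<^sub>v v"
      using rank_one_range[OF B rank v _ x] Bv v0 by metis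
    have "x \<bullet>c v = c" using selfadj[OF x] unfolding c using v vv by simp
    hence eq: "x - ?H *\<^sub>v (A *\<^sub>v x) = (x \<bullet>c v) \<cdot>\<^sub>v v" using c Bx[OF x] by simp
    have "?H *\<^sub>v (A *\<^sub>v x) = x - (x - ?H *\<^sub>v (A *\<^sub>v x))"
      using x A H by (intro eq_vecI) auto
    thus ?thesis unfolding eq .
  qed
  show ?thesis by (rule that[of v], unfold_locales) (use A v vv Av defect in auto)
qed

theorem proposition3p1:
  fixes n :: nat and A :: "complex mat"
  assumes "S_matrix n A"
    and "\<not> invertible_mat A"
  shows "ascent A = order 0 (char_poly A)
    \<and> (ppi_index A = enat (ascent A) \<or> ppi_index A = \<infinity>)
    \<and> (ppi_index A = \<infinity> \<longleftrightarrow> unitarily_similar A (jordan_block n 0))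
    \<and> (\<forall>j. 1 \<le> j \<and> j \<le> ascent A \<longrightarrow>
         int (vec_space.rank n (A ^\<^sub>m j)) = int n - int j)"
proof -
  have ev: "\<And>z. eigenvalue A z \<Longrightarrow> cmod z < 1" using assms(1) unfolding S_matrix_def by blast
  obtain v where "kernel_defect n A v" using S_matrix_kernel_defect[OF assms] .
  then interpret kernel_defect n A v .
  define a where "a = ascent A"
  note ascent = ascent_eq_order[OF A kernel_dim_A]
  have dim: "kernel_dim (A ^\<^sub>m k) = min k a" for k
    unfolding a_def ascent by (rule kernel_dim_pow_eq_min[OF A kernel_dim_A])
  \<comment> \<open>Being positive, the ascent has a predecessor b, the top index of the chain e_0,
    ..., e_b.\<close>
  have "a \<noteq> 0" using dim[of 1] kernel_dim_A A by auto
  then obtain b where ab: "a = Suc b" by (cases a) auto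
  have "mat_kernel (A ^\<^sub>m b) \<noteq> mat_kernel (A ^\<^sub>m Suc b)"
  proof
    assume "mat_kernel (A ^\<^sub>m b) = mat_kernel (A ^\<^sub>m Suc b)"
    hence "kernel_dim (A ^\<^sub>m b) = kernel_dim (A ^\<^sub>m Suc b)"
      by (intro kernel_dim_cong) (use A in auto)
    thus False unfolding dim ab by simp
  qed
  with mat_kernel_pow_subset[OF A, of b "Suc b"] obtain w where
    "w \<in> mat_kernel (A ^\<^sub>m Suc b)" "w \<notin> mat_kernel (A ^\<^sub>m b)" by auto
  then interpret kernel_chain n A v b w
    by unfold_locales (auto simp: mem_mat_kernel_pow[OF A] simp del: pow_mat.simps)
  have stable: "mat_kernel (A ^\<^sub>m Suc (Suc b)) = mat_kernel (A ^\<^sub>m Suc b)"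
    by (rule mat_kernel_eqI[symmetric, of _ n])
      (use A mat_kernel_pow_subset[OF A, of "Suc b" "Suc (Suc b)"] dim[of "Suc b"] dim[of "Suc (Suc b)"]
        ab in \<open>auto simp del: pow_mat.simps\<close>)
  have rank: "vec_space.rank n (A ^\<^sub>m k) + min k a = n" for k
    using mat_rank_nullity[OF pow_carrier_mat[OF A], of k] unfolding dim .
  \<comment> \<open>If the power just past the ascent is a partial isometry, the chain has trivial
    orthogonal complement. Then A^a = 0, and rank zero forces n = a, so the chain fills the
    space.\<close>
  have pi_next: "unitarily_similar A (jordan_block n 0)" if "partial_isometry (A ^\<^sub>m Suc a)"
  proof (rule unitarily_similar_jordan_block)
    have "A ^\<^sub>m Suc b = 0\<^sub>m n n"
    proof (rule eq_zero_matI[OF pow_carrier_mat[OF A]])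
      fix x :: "complex vec" assume "x \<in> carrier_vec n"
      show "A ^\<^sub>m Suc b *\<^sub>v x = 0\<^sub>v n"
        by (rule nilpotent[OF _ \<open>x \<in> carrier_vec n\<close>])
          (rule perp_e_eq_0[OF stable that[unfolded ab] no_isometric_vector[OF A ev]])
    qed
    hence "vec_space.rank n (A ^\<^sub>m a) = 0" unfolding ab by (simp add: vec_space.rank_0I)
    thus "n = Suc b" using rank[of a] ab by simp
  qed
  have similar_pi: "partial_isometry (A ^\<^sub>m j)" if "unitarily_similar A (jordan_block n 0)" for j
  proof (cases "j \<le> Suc b")
    case False
    note 0 = unitarily_similar_jordan_block_pow[OF that]
    \<comment> \<open>A^n = 0 has rank 0, so min n a = n. Exponents above the ascent thus exceed n
      and give the zero matrix, a partial isometry.\<close>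
    have "n \<le> a" using rank[of n] unfolding 0 by (simp add: vec_space.rank_0I)
    hence j: "j = (j - n) + n" using False ab by simp
    have "A ^\<^sub>m j = 0\<^sub>m n n"
    proof (rule eq_zero_matI[OF pow_carrier_mat[OF A]])
      fix x :: "complex vec" assume x: "x \<in> carrier_vec n"
      have "A ^\<^sub>m j *\<^sub>v x = A ^\<^sub>m (j - n) *\<^sub>v 0\<^sub>v n"
        by (subst j, subst pow_mat_add_mult_vec[OF A x], subst 0) (use x in \<open>auto intro!: arg_cong[where f = "\<lambda>y. _ *\<^sub>v y"] eq_vecI\<close>)
      thus "A ^\<^sub>m j *\<^sub>v x = 0\<^sub>v n" using mult_mat_zero_vec[OF pow_carrier_mat[OF A], of "j - n"] by simp
    qed
    thus ?thesis by (simp add: partial_isometry_zero)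
  qed (rule partial_isometry_pow)
  \<comment> \<open>All powers up to the ascent are partial isometries; the next one is such exactly
    in the Jordan block case, and then all powers are.\<close>
  have index: "ppi_index A = (if unitarily_similar A (jordan_block n 0) then \<infinity> else enat a)"
    using ppi_index_eq_infinity[OF similar_pi] pi_next partial_isometry_pow
      ppi_index_eq_enat[of a A] ab by auto
  have "int (vec_space.rank n (A ^\<^sub>m j)) = int n - int j" if "j \<le> a" for j
    using rank[of j] that by simp
  with index ascent show ?thesis unfolding a_def[symmetric] by simp
qed

end
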